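(* Let $X$ be a locally convex topological vector space, let $f\colon X\to(-\infty,\infty]$ be a proper convex function, and let $g\colon X\to[-\infty,\infty)$ be a proper concave function such that there exists $\hat{x}\in X$ satisfying $\inf\{f(x)-g(x)\mid x\in X\}=f(\hat{x})-g(\hat{x})$. Suppose that the sets $\mathrm{dom}(f)-\mathrm{dom}(g)$, $\mathrm{epi}(f)$, and $\mathrm{epi}(f)-\mathrm{hypo}(g)$ have nonempty relative interiors and that $\mathrm{ri}(\mathrm{dom}(f))\cap\mathrm{ri}(\mathrm{dom}(g))\neq\emptyset$. Then $$\inf\{f(x)-g(x)\mid x\in X\}=\sup\{g_*(x^* )-f^*(x^* )\mid x^*\in X^*\}.$$
   Context: All spaces are real Hausdorff topological vector spaces; $X^*$ is the topological dual of $X$ and $\langle x^*,x\rangle:=x^*(x)$. For sets $A,B$ in a vector space, $A-B:=\{a-b\mid a\in A,\ b\in B\}$. For a convex subset $\Omega$ of a topological vector space, the relative interior is $\mathrm{ri}(\Omega):=\{x\in\Omega\mid \text{there exists a neighborhood }V\text{ of }x\text{ with }V\cap\overline{\mathrm{aff}}(\Omega)\subset\Omega\}$, where $\overline{\mathrm{aff}}(\Omega)$ is the closure of the affine hull of $\Omega$. For $f\colon X\to(-\infty,\infty]$: $\mathrm{dom}(f):=\{x\in X\mid f(x)<\infty\}$, $\mathrm{epi}(f):=\{(x,\alpha)\in X\times\mathbb{R}\mid \alpha\ge f(x)\}$; $f$ is convex if $\mathrm{epi}(f)$ is convex and proper if $\mathrm{dom}(f)\ne\emptyset$. For $g\colon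 X\to[-\infty,\infty)$: $g$ is concave (proper) if $-g$ is convex (proper), $\mathrm{dom}(g):=\{x\in X\mid g(x)>-\infty\}$, $\mathrm{hypo}(g):=\{(x,\alpha)\in X\times\mathbb{R}\mid \alpha\le g(x)\}$. The convex Fenchel conjugate of $f$ is $f^*(x^* ):=\sup\{\langle x^*,x\rangle-f(x)\mid x\in X\}$, and the concave Fenchel conjugate of $g$ is $g_*(x^* ):=\inf\{\langle x^*,x\rangle-g(x)\mid x\in X\}$, for $x^*\in X^*$. *)

theory Defs
  imports "HOL-Analysis.Analysis"
begin

text \<open>
  Hausdorffness is part of the notion of topological vector space here.
\<close>

class topological_real_vector = real_vector + topological_ab_group_add + t2_space +
  assumes tendsto_scaleR_Pair:
    "LIM p (nhds a \<times>\<^sub>F nhds b). fst p *\<^sub>R snd p :> nhds (a *\<^sub>R b)"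

text \<open>
  Every neighbourhood of the origin contains a convex neighbourhood of the origin. Convexity and
  \<open>0 \<in> interior V\<close> are unfolded, since \<^const>\<open>convex\<close> and \<^const>\<open>interior\<close> are not usable inside a
  class specification; the lemma below restates the axiom with them.
\<close>

class locally_convex_real_vector = topological_real_vector +
  assumes locally_convex_nhds:
    "open U \<Longrightarrow> 0 \<in> U \<Longrightarrow>
      \<exists>V. (\<forall>x\<in>V. \<forall>y\<in>V. \<forall>u\<ge>0. \<forall>v\<ge>0. u + v = 1 \<longrightarrow> u *\<^sub>R x + v *\<^sub>R y \<in> V) \<and>
          (\<exists>W. open W \<and> 0 \<in> W \<and> W \<subseteq> V) \<and> V \<subseteq> U"

lemma locally_convex:
  fixes U :: "'a::locally_convex_real_vector set"
  assumes "open U" "0 \<in> U"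
  shows "\<exists>V. convex V \<and> 0 \<in> interior V \<and> V \<subseteq> U"
  using locally_convex_nhds[OF assms] unfolding convex_def interior_def by blast

definition topological_dual :: "('a::topological_real_vector \<Rightarrow> real) set" where
  "topological_dual = {\<phi>. linear \<phi> \<and> continuous_on UNIV \<phi>}"

text \<open>
  The library's \<^const>\<open>rel_interior\<close> is relative to the affine hull; here the interior is taken
  relative to the \<^emph>\<open>closed\<close> affine hull. The two differ in infinite dimensions.
\<close>

definition ri :: "'a::{real_vector, topological_space} set \<Rightarrow> 'a set" where
  "ri \<Omega> = {x \<in> \<Omega>. \<exists>V. x \<in> interior V \<and> V \<inter> closure (affine hull \<Omega>) \<subseteq> \<Omega>}"

text \<open>The symbol \<open>-\<close> on sets is the complement-type difference, hence a separate name.\<close>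

definition algebraic_diff :: "'a::minus set \<Rightarrow> 'a set \<Rightarrow> 'a set" where
  "algebraic_diff A B = {a - b | a b. a \<in> A \<and> b \<in> B}"

text \<open>
  Functions with values in \<open>(-\<infinity>, \<infinity>]\<close> or \<open>[-\<infinity>, \<infinity>)\<close> are rendered as \<^typ>\<open>ereal\<close>-valued
  functions; the restriction on the values is stated separately where it is assumed.
\<close>

definition effective_dom :: "('a \<Rightarrow> ereal) \<Rightarrow> 'a set" where
  "effective_dom f = {x. f x < \<infinity>}"

definition epi :: "('a \<Rightarrow> ereal) \<Rightarrow> ('a \<times> real) set" where
  "epi f = {(x, \<alpha>). f x \<le> ereal \<alpha>}"

definition convex_fun :: "('a::real_vector \<Rightarrow> ereal) \<Rightarrow> bool" where
  "convex_fun f \<longleftrightarrow> convex (epi f)"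

definition proper_fun :: "('a \<Rightarrow> ereal) \<Rightarrow> bool" where
  "proper_fun f \<longleftrightarrow> effective_dom f \<noteq> {}"

definition concave_dom :: "('a \<Rightarrow> ereal) \<Rightarrow> 'a set" where
  "concave_dom g = {x. - \<infinity> < g x}"

definition hypo :: "('a \<Rightarrow> ereal) \<Rightarrow> ('a \<times> real) set" where
  "hypo g = {(x, \<alpha>). ereal \<alpha> \<le> g x}"

definition concave_fun :: "('a::real_vector \<Rightarrow> ereal) \<Rightarrow> bool" where
  "concave_fun g \<longleftrightarrow> convex_fun (\<lambda>x. - g x)"

definition proper_concave_fun :: "('a \<Rightarrow> ereal) \<Rightarrow> bool" where
  "proper_concave_fun g \<longleftrightarrow> proper_fun (\<lambda>x. - g x)"

definition convex_conjugate :: "('a \<Rightarrow> ereal) \<Rightarrow> ('a \<Rightarrow> real) \<Rightarrow> ereal" where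
  "convex_conjugate f \<phi> = (SUP x. ereal (\<phi> x) - f x)"

definition concave_conjugate :: "('a \<Rightarrow> ereal) \<Rightarrow> ('a \<Rightarrow> real) \<Rightarrow> ereal" where
  "concave_conjugate g \<phi> = (INF x. ereal (\<phi> x) - g x)"

end

theory Submission
  imports Defs
begin

text \<open>
  Weak duality is immediate from the two conjugates: both are compared with their term at the same
  point \<open>x\<close>, and \<open>\<phi> x\<close> cancels. The content lies in producing one continuous functional \<open>\<phi>\<close> whose
  dual value reaches the infimum \<open>\<nu>\<close>, a real number because it is attained and the domains meet.

  Put \<open>E = epi f - hypo g\<close>. This is a convex subset of \<open>X \<times> \<real>\<close>, and its points over the
  origin are the \<open>(0, a - b)\<close> with \<open>f x \<le> a\<close> and \<open>b \<le> g x\<close> for some \<open>x\<close>. Since the infimum is attained,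
  \<open>(0, \<nu>)\<close> is the lowest of them: the points vertically below it lie outside \<open>E\<close>, those above it inside. So
  \<open>(0, \<nu>)\<close> is a relative boundary point of \<open>E\<close>, and as \<open>E\<close> has a relative interior point there is a
  continuous functional \<open>(x, a) \<mapsto> \<psi> x + \<kappa> a\<close> that supports \<open>E\<close> at \<open>(0, \<nu>)\<close> and is not constant on \<open>E\<close>
  (\<open>supporting_functional_at_bottom\<close>). Moving upwards in \<open>E\<close> shows \<open>\<kappa> \<ge> 0\<close>. If \<open>\<kappa>\<close> were zero, \<open>\<psi>\<close> would
  be nonnegative on \<open>dom f - dom g\<close>; but a common relative interior point of the two domains lets one
  step a little backwards, so \<open>\<psi>\<close> would vanish there (\<open>nonneg_functional_vanishes\<close>), and the
  supporting functional would be constant. Hence \<open>\<kappa> > 0\<close>, and \<open>\<phi> = - \<psi> / \<kappa>\<close> turns the support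
  inequality into \<open>\<nu> + (\<phi> u - a) \<le> \<phi> v - b\<close> whenever \<open>f u \<le> a\<close> and \<open>b \<le> g v\<close>, which says that the dual
  value at \<open>\<phi>\<close> is at least \<open>\<nu>\<close> (\<open>conjugate_gap_ge\<close>).

  The supporting functional comes from the Hahn--Banach theorem, proved for sublinear functionals by
  showing that a minimal sublinear functional is linear. To avoid separating inside the affine hull of
  \<open>E\<close> and extending afterwards, the theorem is applied once, in the whole space, to the gauge of a
  convex neighbourhood from which the cone generated by \<open>E - (0, \<nu>)\<close> has been subtracted
  (\<open>separation_relative\<close>): the cone forces nonnegativity on \<open>E - (0, \<nu>)\<close>, the neighbourhood forces
  continuity.
\<close>

section \<open>The Hahn--Banach theorem for sublinear functionals\<close>

definition sublinear :: "('a::real_vector \<Rightarrow> real) \<Rightarrow> bool" where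
  "sublinear p \<longleftrightarrow>
    (\<forall>x y. p (x + y) \<le> p x + p y) \<and> (\<forall>x. \<forall>t\<ge>0. p (t *\<^sub>R x) = t * p x)"

lemma sublinear_add: "sublinear p \<Longrightarrow> p (x + y) \<le> p x + p y"
  by (simp add: sublinear_def)

lemma sublinear_scaleR: "sublinear p \<Longrightarrow> 0 \<le> t \<Longrightarrow> p (t *\<^sub>R x) = t * p x"
  by (simp add: sublinear_def)

lemma sublinear_zero: "sublinear p \<Longrightarrow> p 0 = 0"
  using sublinear_scaleR[of p 0 0] by simp

lemma sublinear_minus: "sublinear p \<Longrightarrow> - p (- x) \<le> p x"
  using sublinear_add[of p x "- x"] by (simp add: sublinear_zero)

lemma sublinearI:
  assumes add: "\<And>x y. p (x + y) \<le> p x + p y"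
    and scale: "\<And>x t. 0 < t \<Longrightarrow> p (t *\<^sub>R x) \<le> t * p x"
    and zero: "p 0 \<le> 0"
  shows "sublinear p"
proof -
  have "p 0 = 0"
    using zero add[of 0 0] by simp
  moreover have "p (t *\<^sub>R x) = t * p x" if "0 < t" for t x
  proof (rule antisym)
    have "t * p ((1 / t) *\<^sub>R (t *\<^sub>R x)) \<le> t * ((1 / t) * p (t *\<^sub>R x))"
      using that by (intro mult_left_mono scale) auto
    then show "t * p x \<le> p (t *\<^sub>R x)"
      using that by simp
  qed (use that scale in auto)
  ultimately show ?thesis
    unfolding sublinear_def using add by (metis less_eq_real_def mult_zero_left scaleR_zero_left)
qed

text \<open>
  For sublinear \<open>p\<close> this is the largest sublinear functional below \<open>p\<close> that is linear along the line
  spanned by \<open>y\<close> with the value \<open>p y\<close> at \<open>y\<close>: any sublinear \<open>q \<le> p\<close> with \<open>q (- y) = - p y\<close>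
  satisfies \<open>q x \<le> q (x + t y) + t q (- y) \<le> p (x + t y) - t p y\<close> for all \<open>t \<ge> 0\<close>. It is used twice, to show that minimal sublinear functionals are additive and to prescribe the value of the
  Hahn--Banach functional at one point.
\<close>

definition linearize_along :: "('a::real_vector \<Rightarrow> real) \<Rightarrow> 'a \<Rightarrow> 'a \<Rightarrow> real" where
  "linearize_along p y x = (INF t\<in>{0..}. p (x + t *\<^sub>R y) - t * p y)"

lemma linearize_along_le:
  assumes "sublinear p" "0 \<le> t"
  shows "linearize_along p y x \<le> p (x + t *\<^sub>R y) - t * p y"
  unfolding linearize_along_def
proof (rule cINF_lower)
  have "- p (- x) \<le> p (x + s *\<^sub>R y) - s * p y" if "0 \<le> s" for s
    using sublinear_add[OF assms(1), of "x + s *\<^sub>R y" "- x"] that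
    by (simp add: sublinear_scaleR[OF assms(1)])
  then show "bdd_below ((\<lambda>t. p (x + t *\<^sub>R y) - t * p y) ` {0..})"
    by (intro bdd_belowI2[where m = "- p (- x)"]) auto
qed (use assms in auto)

lemma le_linearize_along:
  assumes "\<And>t. 0 \<le> t \<Longrightarrow> b \<le> p (x + t *\<^sub>R y) - t * p y"
  shows "b \<le> linearize_along p y x"
  unfolding linearize_along_def using assms by (intro cINF_greatest) auto

text \<open>
  For subadditivity, the competitors \<open>s\<close> for \<open>u\<close> and \<open>t\<close> for \<open>v\<close> combine to the competitor \<open>s + t\<close> for
  \<open>u + v\<close>; for homogeneity, \<open>t\<close> for \<open>x\<close> corresponds to \<open>r t\<close> for \<open>r x\<close>.
\<close>

lemma sublinear_linearize_along:
  assumes p: "sublinear p"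
  shows "sublinear (linearize_along p y)"
proof (rule sublinearI)
  let ?q = "linearize_along p y"
  fix u v
  have "?q (u + v) - (p (v + t *\<^sub>R y) - t * p y) \<le> p (u + s *\<^sub>R y) - s * p y"
    if "0 \<le> s" "0 \<le> t" for s t
  proof -
    have "?q (u + v) \<le> p ((u + v) + (s + t) *\<^sub>R y) - (s + t) * p y"
      using p that by (intro linearize_along_le) auto
    moreover have "(u + v) + (s + t) *\<^sub>R y = (u + s *\<^sub>R y) + (v + t *\<^sub>R y)"
      by (simp add: algebra_simps)
    ultimately show ?thesis
      using sublinear_add[OF p, of "u + s *\<^sub>R y" "v + t *\<^sub>R y"] by (simp add: algebra_simps)
  qed
  then have "?q (u + v) - (p (v + t *\<^sub>R y) - t * p y) \<le> ?q u" if "0 \<le> t" for t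
    using that by (intro le_linearize_along)
  then have "?q (u + v) - ?q u \<le> ?q v"
    by (intro le_linearize_along) (smt (verit))
  then show "?q (u + v) \<le> ?q u + ?q v"
    by simp
next
  let ?q = "linearize_along p y"
  fix x and r :: real
  assume r: "0 < r"
  have "?q (r *\<^sub>R x) / r \<le> p (x + t *\<^sub>R y) - t * p y" if "0 \<le> t" for t
  proof -
    have "?q (r *\<^sub>R x) \<le> p (r *\<^sub>R x + (r * t) *\<^sub>R y) - (r * t) * p y"
      using p r that by (intro linearize_along_le) auto
    also have "r *\<^sub>R x + (r * t) *\<^sub>R y = r *\<^sub>R (x + t *\<^sub>R y)"
      by (simp add: scaleR_add_right)
    also have "p \<dots> - (r * t) * p y = r * (p (x + t *\<^sub>R y) - t * p y)"
      using r by (simp add: sublinear_scaleR[OF p] right_diff_distrib del: scaleR_add_right)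
    finally show ?thesis
      using r by (simp add: divide_simps mult.commute)
  qed
  then have "?q (r *\<^sub>R x) / r \<le> ?q x"
    by (rule le_linearize_along)
  then show "?q (r *\<^sub>R x) \<le> r * ?q x"
    using r by (simp add: divide_simps mult.commute)
next
  show "linearize_along p y 0 \<le> 0"
    using linearize_along_le[OF p, of 0 y 0] by (simp add: sublinear_zero[OF p])
qed

lemma linearize_along_below: "sublinear p \<Longrightarrow> linearize_along p y x \<le> p x"
  using linearize_along_le[of p 0 y x] by simp

text \<open>
  Minimality makes linearizing along any direction leave \<open>m\<close> unchanged. The competitor \<open>t = 1\<close> then reads
  \<open>m x \<le> m (x + y) - m y\<close>, which is the missing half of additivity.
\<close>

lemma minimal_sublinear_is_linear:
  assumes m: "sublinear m"
    and minimal: "\<And>q. sublinear q \<Longrightarrow> q \<le> m \<Longrightarrow> q = m"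
  shows "linear m"
proof -
  have add: "m (x + y) = m x + m y" for x y
  proof (rule antisym)
    have "linearize_along m y = m"
      using m by (intro minimal sublinear_linearize_along) (auto simp: le_fun_def linearize_along_below)
    then show "m x + m y \<le> m (x + y)"
      using linearize_along_le[OF m, of 1 y x] by simp
  qed (rule sublinear_add[OF m])
  have neg: "m (- x) = - m x" for x
    using add[of x "- x"] by (simp add: sublinear_zero[OF m])
  have "m (r *\<^sub>R x) = r * m x" for r x
  proof (cases "0 \<le> r")
    case False
    then have "m ((- r) *\<^sub>R x) = (- r) * m x"
      by (intro sublinear_scaleR[OF m]) simp
    then show ?thesis
      by (simp add: neg)
  qed (rule sublinear_scaleR[OF m])
  then show ?thesis
    using add by (intro linearI) auto
qed

text \<open>
  The lower bound that Zorn's lemma needs is the pointwise infimum. It is finite because every member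
  \<open>q\<close> satisfies \<open>q x \<ge> - q (- x) \<ge> - p (- x)\<close>, and subadditive because any two members of a chain have a
  common lower bound within the chain.
\<close>

lemma sublinear_Inf_chain:
  assumes "C \<noteq> {}" and sub: "\<And>q. q \<in> C \<Longrightarrow> sublinear q \<and> q \<le> p"
    and chain: "\<And>q r. q \<in> C \<Longrightarrow> r \<in> C \<Longrightarrow> q \<le> r \<or> r \<le> q"
  shows "\<exists>u. sublinear u \<and> (\<forall>q\<in>C. u \<le> q)"
proof -
  define u where "u x = (INF q\<in>C. q x)" for x
  have bdd: "bdd_below ((\<lambda>q. q x) ` C)" for x
  proof (rule bdd_belowI2)
    fix q assume "q \<in> C"
    then show "- p (- x) \<le> q x"
      using sub[of q] sublinear_minus[of q x] le_funD[of q p "- x"] by linarith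
  qed
  have le: "u x \<le> q x" if "q \<in> C" for q x
    unfolding u_def using that by (intro cINF_lower bdd)
  have ge: "b \<le> u x" if "\<And>q. q \<in> C \<Longrightarrow> b \<le> q x" for b x
    unfolding u_def using that assms(1) by (intro cINF_greatest)
  have "sublinear u"
  proof (rule sublinearI)
    fix x y
    have "u (x + y) - r y \<le> q x" if qr: "q \<in> C" "r \<in> C" for q r
    proof -
      obtain s where s: "s \<in> C" "s \<le> q" "s \<le> r"
        using chain[OF qr] qr by blast
      have "u (x + y) \<le> s (x + y)"
        using s by (intro le)
      also have "\<dots> \<le> s x + s y"
        using sub s by (simp add: sublinear_add)
      also have "\<dots> \<le> q x + r y"
        using s by (intro add_mono) (auto simp: le_fun_def)
      finally show ?thesis by simp
    qed
    then have "u (x + y) - r y \<le> u x" if "r \<in> C" for r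
      using that by (intro ge)
    then have "u (x + y) - u x \<le> u y"
      by (intro ge) (smt (verit))
    then show "u (x + y) \<le> u x + u y"
      by simp
  next
    fix x and t :: real
    assume t: "0 < t"
    have "u (t *\<^sub>R x) / t \<le> u x"
    proof (rule ge)
      fix q assume "q \<in> C"
      then show "u (t *\<^sub>R x) / t \<le> q x"
        using le[of q "t *\<^sub>R x"] sub[of q] t
        by (simp add: sublinear_scaleR divide_simps mult.commute)
    qed
    then show "u (t *\<^sub>R x) \<le> t * u x"
      using t by (simp add: divide_simps mult.commute)
  next
    obtain q where "q \<in> C" using assms(1) by blast
    then show "u 0 \<le> 0"
      using le[of q 0] sub[of q] by (simp add: sublinear_zero)
  qed
  then show ?thesis
    using le by (auto simp: le_fun_def)
qed

text \<open>
  Instead of extending a functional from a line, a minimal sublinear functional is taken below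
  \<open>linearize_along p c\<close>, whose value at \<open>- c\<close> is at most \<open>- p c\<close>. This pins the value at \<open>c\<close>.
\<close>

theorem Hahn_Banach_sublinear:
  fixes p :: "'a::real_vector \<Rightarrow> real"
  assumes p: "sublinear p"
  obtains F :: "'a \<Rightarrow> real" where "linear F" "\<And>x. F x \<le> p x" "F c = p c"
proof -
  define p' where "p' = linearize_along p c"
  have p': "sublinear p'"
    unfolding p'_def by (rule sublinear_linearize_along[OF p])
  define S where "S = {q. sublinear q \<and> q \<le> p'}"
  have "\<exists>m\<in>S. \<forall>q\<in>S. m \<ge> q \<longrightarrow> q = m"
  proof (rule predicate_Zorn)
    show "partial_order_on S (relation_of (\<ge>) S)"
      by (rule partial_order_on_relation_ofI) auto
  next
    fix C assume C: "C \<in> Chains (relation_of (\<ge>) S)"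
    show "\<exists>u\<in>S. \<forall>q\<in>C. q \<ge> u"
    proof (cases "C = {}")
      case True
      then show ?thesis
        using p' by (auto simp: S_def)
    next
      case False
      have CS: "C \<subseteq> S"
        using C by (rule Chains_relation_of)
      have "\<exists>u. sublinear u \<and> (\<forall>q\<in>C. u \<le> q)"
      proof (rule sublinear_Inf_chain[OF False])
        show "sublinear q \<and> q \<le> p'" if "q \<in> C" for q
          using that CS by (auto simp: S_def)
        show "q \<le> r \<or> r \<le> q" if "q \<in> C" "r \<in> C" for q r
          using that C by (auto simp: Chains_def relation_of_def)
      qed
      then obtain u where u: "sublinear u" "\<And>q. q \<in> C \<Longrightarrow> u \<le> q"
        by blast
      moreover have "u \<le> p'"
        using False CS u(2) by (force simp: S_def intro: order_trans)
      ultimately show ?thesis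
        by (auto simp: S_def)
    qed
  qed
  then obtain F where F: "sublinear F" "F \<le> p'"
    and minimal: "\<And>q. sublinear q \<Longrightarrow> q \<le> F \<Longrightarrow> q = F"
    unfolding S_def by (metis (mono_tags, lifting) mem_Collect_eq order_trans)
  have lin: "linear F"
    using F(1) minimal by (rule minimal_sublinear_is_linear)
  have below: "F x \<le> p x" for x
    using le_funD[OF F(2), of x] linearize_along_below[OF p, of c x] by (simp add: p'_def)
  have "F (- c) \<le> - p c"
    using le_funD[OF F(2), of "- c"] linearize_along_le[OF p, of 1 c "- c"]
    by (simp add: p'_def sublinear_zero[OF p])
  then have "F c = p c"
    using below[of c] by (simp add: linear_neg[OF lin])
  with lin below show thesis
    by (rule that)
qed

section \<open>Separation of convex sets in a real vector space\<close>

text \<open>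
  The functional is dominated by the gauge of \<open>U\<close>, which is at most 1 on \<open>U\<close> and at least 1 outside.
\<close>

theorem separation_from_absorbing_convex:
  fixes U :: "'a::real_vector set"
  assumes U: "convex U" and absorbing: "\<And>x. \<exists>t>0. t *\<^sub>R x \<in> U" and c: "c \<notin> U"
  shows "\<exists>F. linear F \<and> (\<forall>x\<in>U. F x \<le> 1) \<and> (1::real) \<le> F c"
proof -
  define T where "T x = {t. 0 < t \<and> (1 / t) *\<^sub>R x \<in> U}" for x
  define p where "p x = Inf (T x)" for x
  have U0: "0 \<in> U"
    using absorbing[of 0] by simp
  have bdd: "bdd_below (T x)" for x
    by (rule bdd_belowI[of _ 0]) (auto simp: T_def)
  have ne: "T x \<noteq> {}" for x
  proof -
    obtain t where "t > 0" "t *\<^sub>R x \<in> U"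
      using absorbing by blast
    then have "1 / t \<in> T x"
      by (simp add: T_def)
    then show ?thesis by blast
  qed
  have le: "p x \<le> t" if "t \<in> T x" for t x
    unfolding p_def using that bdd by (rule cInf_lower)
  have ge: "b \<le> p x" if "\<And>t. t \<in> T x \<Longrightarrow> b \<le> t" for b x
    unfolding p_def using ne that by (rule cInf_greatest)
  have "sublinear p"
  proof (rule sublinearI)
    fix x y
    have "p (x + y) - t \<le> s" if s: "s \<in> T x" and t: "t \<in> T y" for s t
    proof -
      have pos: "0 < s" "0 < t"
        using s t by (auto simp: T_def)
      have "(s / (s + t)) *\<^sub>R ((1 / s) *\<^sub>R x) + (t / (s + t)) *\<^sub>R ((1 / t) *\<^sub>R y) \<in> U"
        using s t pos by (intro convexD[OF U]) (auto simp: T_def add_divide_distrib[symmetric])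
      then have "(1 / (s + t)) *\<^sub>R (x + y) \<in> U"
        using pos by (simp add: scaleR_add_right)
      then have "s + t \<in> T (x + y)"
        using pos by (simp add: T_def)
      then show ?thesis
        using le by fastforce
    qed
    then have "p (x + y) - t \<le> p x" if "t \<in> T y" for t
      using that by (intro ge)
    then have "p (x + y) - p x \<le> p y"
      by (intro ge) (smt (verit))
    then show "p (x + y) \<le> p x + p y"
      by simp
  next
    fix x and r :: real
    assume r: "0 < r"
    have "p (r *\<^sub>R x) / r \<le> p x"
    proof (rule ge)
      fix t assume "t \<in> T x"
      then have "r * t \<in> T (r *\<^sub>R x)"
        using r by (simp add: T_def)
      then show "p (r *\<^sub>R x) / r \<le> t"
        using le[of "r * t" "r *\<^sub>R x"] r by (simp add: divide_simps mult.commute)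
    qed
    then show "p (r *\<^sub>R x) \<le> r * p x"
      using r by (simp add: divide_simps mult.commute)
  next
    have "p 0 \<le> t" if "0 < t" for t
      using that U0 by (intro le) (simp add: T_def)
    then show "p 0 \<le> 0"
      by (rule field_le_epsilon[of "p 0" 0, simplified])
  qed
  then obtain F where F: "linear F" "\<And>x. F x \<le> p x" "F c = p c"
    using Hahn_Banach_sublinear[of p c] by blast
  have "1 \<le> p c"
  proof (rule ge)
    fix t assume t: "t \<in> T c"
    show "1 \<le> t"
    proof (rule ccontr)
      assume "\<not> 1 \<le> t"
      then have "t *\<^sub>R ((1 / t) *\<^sub>R c) + (1 - t) *\<^sub>R 0 \<in> U"
        using t U0 by (intro convexD[OF U]) (auto simp: T_def)
      then show False
        using t c by (simp add: T_def)
    qed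
  qed
  moreover have "p x \<le> 1" if "x \<in> U" for x
    using that by (intro le) (simp add: T_def)
  ultimately show ?thesis
    using F by (intro exI[of _ F]) (auto intro: order_trans)
qed

text \<open>
  The origin lies in \<open>C\<close> but not in its relative interior, because the ray spanned by \<open>e\<close> leaves the
  origin within the span of \<open>C\<close> and never meets \<open>C\<close> again, while \<open>c\<close> is a relative interior point of
  \<open>C\<close> with \<open>W\<close> measuring the room around it. Separating \<open>c\<close> from \<open>U = W / 2 - cone hull C\<close> gives everything
  at once: being bounded above on a set containing a negative cone forces \<open>F \<ge> 0\<close> on \<open>C\<close>, and being
  bounded on \<open>W / 2\<close> yields continuity when \<open>W\<close> is a neighbourhood.

  The point \<open>c\<close> is outside \<open>U\<close>: if \<open>c = w / 2 - s z\<close> with \<open>z \<in> C\<close>, then \<open>- s z\<close> is so close to \<open>c\<close> that even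
  \<open>- s z + r e / 2\<close> is in \<open>C\<close> for a small \<open>r > 0\<close>, and averaging with \<open>z\<close> puts a positive multiple of \<open>e\<close>
  into \<open>C\<close>. The factor one half leaves room for the step along \<open>e\<close>.
\<close>

lemma separation_relative:
  fixes C W :: "'a::real_vector set"
  assumes C: "convex C" "0 \<in> C"
    and W: "convex W" "\<And>x. x \<in> W \<Longrightarrow> - x \<in> W" "\<And>x. \<exists>t>0. t *\<^sub>R x \<in> W"
    and interior: "\<And>h. h \<in> W \<Longrightarrow> h \<in> span C \<Longrightarrow> c + h \<in> C"
    and e: "e \<in> span C" "\<And>t. 0 < t \<Longrightarrow> t *\<^sub>R e \<notin> C"
  shows "\<exists>F. linear F \<and> (\<forall>x\<in>C. 0 \<le> F x) \<and> (0::real) < F c \<and> (\<forall>x\<in>W. F x \<le> 1)"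
proof -
  define K where "K = cone hull C"
  define U where "U = (\<Union>x \<in> (*\<^sub>R) (1/2) ` W. \<Union>y \<in> K. {x - y})"
  have K0: "0 \<in> K"
    using C(2) by (auto simp: K_def hull_inc)
  have convU: "convex U"
    unfolding U_def K_def using C W by (intro convex_differences convex_scaling convex_cone_hull)
  have U_I: "(1/2) *\<^sub>R w - k \<in> U" if "w \<in> W" "k \<in> K" for w k
    unfolding U_def using that by blast
  have half: "(1/2) *\<^sub>R x \<in> U" if "x \<in> W" for x
    using U_I[OF that K0] by simp
  have W0: "0 \<in> W"
    using W(3)[of 0] by simp
  have absorbing: "\<exists>t>0. t *\<^sub>R x \<in> U" for x
  proof -
    obtain t where "t > 0" "t *\<^sub>R x \<in> W"
      using W(3) by blast
    then show ?thesis
      using half[of "t *\<^sub>R x"] by (intro exI[of _ "t / 2"]) simp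
  qed
  have cU: "c \<notin> U"
  proof
    assume "c \<in> U"
    then obtain w k where w: "w \<in> W" and k: "k \<in> K" and c_eq: "c = (1/2) *\<^sub>R w - k"
      by (auto simp: U_def)
    obtain s z where s: "0 \<le> s" and z: "z \<in> C" and k_eq: "k = s *\<^sub>R z"
      using k by (auto simp: K_def cone_hull_expl)
    obtain r where r: "r > 0" "r *\<^sub>R e \<in> W"
      using W(3) by blast
    \<comment> \<open>Adding \<open>h\<close> to \<open>c\<close> replaces the summand \<open>w / 2\<close> of \<open>c\<close> by \<open>r e / 2\<close>.\<close>
    define h where "h = (1/2) *\<^sub>R (r *\<^sub>R e) + (1/2) *\<^sub>R (- w)"
    have cC: "c \<in> C"
      using interior[OF W0] by (simp add: span_zero)
    have "w = 2 *\<^sub>R (c + s *\<^sub>R z)"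
      by (simp add: c_eq k_eq algebra_simps)
    then have "w \<in> span C"
      using cC z by (simp add: span_add span_scale span_base)
    then have "h \<in> span C"
      unfolding h_def using e by (intro span_add span_scale span_neg)
    moreover have "h \<in> W"
      unfolding h_def using r w W by (intro convexD[OF W(1)]) auto
    ultimately have "c + h \<in> C"
      by (intro interior)
    \<comment> \<open>The weights are chosen so that \<open>- s z\<close> and \<open>z\<close> cancel, leaving a multiple of \<open>e\<close>.\<close>
    then have "(1 / (1 + s)) *\<^sub>R (c + h) + (s / (1 + s)) *\<^sub>R z \<in> C"
      using s z by (intro convexD[OF C(1)]) (auto simp: add_divide_distrib[symmetric])
    moreover have "(1 / (1 + s)) *\<^sub>R (c + h) + (s / (1 + s)) *\<^sub>R z = (1 / (1 + s)) *\<^sub>R (c + h + s *\<^sub>R z)"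
      by (simp add: scaleR_add_right)
    moreover have "c + h + s *\<^sub>R z = (r / 2) *\<^sub>R e"
      by (simp add: c_eq k_eq h_def algebra_simps)
    ultimately have "(1 / (1 + s) * (r / 2)) *\<^sub>R e \<in> C"
      by simp
    then show False
      using e(2)[of "1 / (1 + s) * (r / 2)"] r s by simp
  qed
  have "\<exists>F. linear F \<and> (\<forall>x\<in>U. F x \<le> 1) \<and> (1::real) \<le> F c"
    using convU absorbing cU by (rule separation_from_absorbing_convex)
  then obtain F :: "'a \<Rightarrow> real" where F: "linear F" "\<And>x. x \<in> U \<Longrightarrow> F x \<le> 1" "1 \<le> F c"
    by metis
  have nonneg: "0 \<le> F x" if x: "x \<in> C" for x
  proof (rule ccontr)
    assume neg: "\<not> 0 \<le> F x"
    \<comment> \<open>Far enough along the negative ray of \<open>x\<close>, which lies in \<open>U\<close>, \<open>F\<close> would exceed its bound 1.\<close>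
    define t where "t = 2 / - F x"
    have t: "0 \<le> t"
      using neg by (simp add: t_def field_simps)
    have "t *\<^sub>R x \<in> K"
      using x t by (auto simp: K_def cone_hull_expl)
    then have "0 - t *\<^sub>R x \<in> U"
      using U_I[OF W0] by fastforce
    then have "F (0 - t *\<^sub>R x) \<le> 1"
      by (rule F(2))
    moreover have "F (0 - t *\<^sub>R x) = 2"
      using neg by (simp add: linear_neg[OF F(1)] linear_scale[OF F(1)] t_def)
    ultimately show False
      by simp
  qed
  show ?thesis
  proof (intro exI[of _ "\<lambda>x. F ((1/2) *\<^sub>R x)"] conjI ballI)
    show "linear (\<lambda>x. F ((1/2) *\<^sub>R x))"
      using linear_compose[OF linear_scaleR F(1)] by (simp add: comp_def)
    show "F ((1/2) *\<^sub>R x) \<le> 1" if "x \<in> W" for x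
      using that by (intro F(2) half)
    show "0 \<le> F ((1/2) *\<^sub>R x)" if "x \<in> C" for x
      using nonneg[OF that] by (simp add: linear_scale[OF F(1)])
    show "0 < F ((1/2) *\<^sub>R c)"
      using F(3) by (simp add: linear_scale[OF F(1)])
  qed
qed

section \<open>Topological vector spaces and relative interiors\<close>

lemma tendsto_scaleR_topological:
  fixes g :: "'b \<Rightarrow> 'a::topological_real_vector"
  assumes "(f \<longlongrightarrow> a) F" "(g \<longlongrightarrow> b) F"
  shows "((\<lambda>x. f x *\<^sub>R g x) \<longlongrightarrow> a *\<^sub>R b) F"
  using filterlim_compose[OF tendsto_scaleR_Pair filterlim_Pair[OF assms]] by simp

lemma open_contains_short_segment:
  fixes x :: "'a::topological_real_vector"
  assumes "open V" "x \<in> V"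
  shows "\<exists>\<delta>>0. \<forall>t. \<bar>t\<bar> < \<delta> \<longrightarrow> x + t *\<^sub>R h \<in> V"
proof -
  have "((\<lambda>t. x + t *\<^sub>R h) \<longlongrightarrow> x + 0 *\<^sub>R h) (nhds 0)"
    by (intro tendsto_add tendsto_const tendsto_scaleR_topological) (rule filterlim_ident)
  then have "eventually (\<lambda>t. x + t *\<^sub>R h \<in> V) (nhds 0)"
    using assms by (intro topological_tendstoD) auto
  then show ?thesis
    by (simp add: eventually_nhds_metric)
qed

text \<open>
  A one-sided bound is enough: applied to the multiples \<open>(2 / e) (y - x)\<close> and \<open>(2 / e) (x - y)\<close>, both small for
  \<open>y\<close> near \<open>x\<close>, it controls \<open>F y - F x\<close> from both sides.
\<close>

lemma continuous_linear_functionalI: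
  fixes F :: "'a::topological_real_vector \<Rightarrow> real"
  assumes F: "linear F" and N: "open N" "0 \<in> N" "\<And>x. x \<in> N \<Longrightarrow> F x \<le> 1"
  shows "continuous_on UNIV F"
  unfolding continuous_on_eq_continuous_at[OF open_UNIV] isCont_def
proof (intro ballI tendstoI)
  fix x :: 'a and e :: real
  assume e: "0 < e"
  have "((\<lambda>y. (2 / e) *\<^sub>R (y - x)) \<longlongrightarrow> (2 / e) *\<^sub>R (x - x)) (at x)"
    by (intro tendsto_scaleR_topological tendsto_diff tendsto_const tendsto_ident_at)
  moreover have "((\<lambda>y. (2 / e) *\<^sub>R (x - y)) \<longlongrightarrow> (2 / e) *\<^sub>R (x - x)) (at x)"
    by (intro tendsto_scaleR_topological tendsto_diff tendsto_const tendsto_ident_at)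
  ultimately have "eventually (\<lambda>y. (2 / e) *\<^sub>R (y - x) \<in> N) (at x)"
    "eventually (\<lambda>y. (2 / e) *\<^sub>R (x - y) \<in> N) (at x)"
    using N by (auto intro: topological_tendstoD)
  then show "eventually (\<lambda>y. dist (F y) (F x) < e) (at x)"
  proof eventually_elim
    case (elim y)
    from elim[THEN N(3)] have "F y - F x \<le> e / 2" "F x - F y \<le> e / 2"
      using e by (simp_all add: linear_scale[OF F] linear_diff[OF F] field_simps)
    then show ?case
      using e by (simp add: dist_real_def)
  qed
qed

text \<open>
  The points in question lie on the line through \<open>x\<close> and \<open>y\<close>, hence in the affine hull of \<open>\<Omega>\<close>, and they
  are close to \<open>x\<close>.
\<close>

lemma ri_extend_beyond:
  fixes \<Omega> :: "'a::topological_real_vector set"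
  assumes x: "x \<in> ri \<Omega>" and y: "y \<in> \<Omega>"
  shows "\<exists>\<delta>>0. \<forall>t. \<bar>t\<bar> < \<delta> \<longrightarrow> x + t *\<^sub>R (x - y) \<in> \<Omega>"
proof -
  obtain V where V: "x \<in> interior V" "V \<inter> closure (affine hull \<Omega>) \<subseteq> \<Omega>" and x\<Omega>: "x \<in> \<Omega>"
    using x by (auto simp: ri_def)
  obtain \<delta> where \<delta>: "\<delta> > 0" "\<And>t. \<bar>t\<bar> < \<delta> \<Longrightarrow> x + t *\<^sub>R (x - y) \<in> interior V"
    using open_contains_short_segment[OF open_interior V(1)] by blast
  have "x + t *\<^sub>R (x - y) \<in> affine hull \<Omega>" for t
  proof -
    have "(1 + t) *\<^sub>R x + (- t) *\<^sub>R y \<in> affine hull \<Omega>"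
      using x\<Omega> y by (intro mem_affine) (auto simp: hull_inc)
    then show ?thesis
      by (simp add: algebra_simps)
  qed
  then show ?thesis
    using \<delta> V(2) closure_subset interior_subset by blast
qed

text \<open>
  With \<open>u\<close> and \<open>v\<close> mirrored at the common relative interior point and pulled in by a factor \<open>t\<close>, the
  difference of the two mirror images is \<open>- t (u - v)\<close>, so nonnegativity applies to it too.
\<close>

lemma nonneg_functional_vanishes:
  fixes A B :: "'a::topological_real_vector set"
  assumes x0: "x\<^sub>0 \<in> ri A \<inter> ri B" and \<psi>: "linear \<psi>"
    and nonneg: "\<And>u v. u \<in> A \<Longrightarrow> v \<in> B \<Longrightarrow> (0::real) \<le> \<psi> (u - v)"
    and uv: "u \<in> A" "v \<in> B"
  shows "\<psi> (u - v) = 0"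
proof -
  obtain \<delta> where \<delta>: "\<delta> > 0" "\<And>t. \<bar>t\<bar> < \<delta> \<Longrightarrow> x\<^sub>0 + t *\<^sub>R (x\<^sub>0 - u) \<in> A"
    using ri_extend_beyond[of x\<^sub>0 A u] x0 uv by blast
  obtain \<delta>' where \<delta>': "\<delta>' > 0" "\<And>t. \<bar>t\<bar> < \<delta>' \<Longrightarrow> x\<^sub>0 + t *\<^sub>R (x\<^sub>0 - v) \<in> B"
    using ri_extend_beyond[of x\<^sub>0 B v] x0 uv by blast
  define t where "t = min \<delta> \<delta>' / 2"
  have t: "0 < t" "\<bar>t\<bar> < \<delta>" "\<bar>t\<bar> < \<delta>'"
    using \<delta>(1) \<delta>'(1) by (auto simp: t_def)
  have "0 \<le> \<psi> ((x\<^sub>0 + t *\<^sub>R (x\<^sub>0 - u)) - (x\<^sub>0 + t *\<^sub>R (x\<^sub>0 - v)))"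
    using t \<delta>(2) \<delta>'(2) by (intro nonneg)
  also have "(x\<^sub>0 + t *\<^sub>R (x\<^sub>0 - u)) - (x\<^sub>0 + t *\<^sub>R (x\<^sub>0 - v)) = (- t) *\<^sub>R (u - v)"
    by (simp add: algebra_simps)
  finally have "\<psi> (u - v) \<le> 0"
    using t(1) by (simp only: linear_scale[OF \<psi>]) (simp add: mult_le_0_iff)
  with nonneg[OF uv] show ?thesis
    by simp
qed

section \<open>Supporting functionals\<close>

lemma mem_translation_iff:
  fixes q :: "'a::ab_group_add"
  shows "p \<in> (+) (- q) ` S \<longleftrightarrow> p + q \<in> S"
proof
  show "p + q \<in> S \<Longrightarrow> p \<in> (+) (- q) ` S"
    by (rule image_eqI[of _ _ "p + q"]) auto
qed auto

text \<open>
  After \<open>(z, \<nu>)\<close> has been moved to the origin, the downward vertical direction \<open>(0, - 1)\<close> is the ray of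
  \<open>separation_relative\<close>: it lies in the span because \<open>E\<close> has a point above \<open>(z, \<nu>)\<close>, and it avoids \<open>E\<close>
  because \<open>(z, \<nu>)\<close> is the bottom. Local convexity provides the convex symmetric neighbourhood \<open>W\<close> around a
  relative interior point.
\<close>

lemma supporting_functional_at_bottom:
  fixes E :: "('a::locally_convex_real_vector \<times> real) set"
  assumes E: "convex E" "ri E \<noteq> {}"
    and bottom: "(z, \<nu>) \<in> E" "\<And>\<mu>. \<mu> < \<nu> \<Longrightarrow> (z, \<mu>) \<notin> E"
    and above: "(z, \<rho>) \<in> E" "\<nu> < \<rho>"
  obtains \<psi> \<kappa> where "\<psi> \<in> topological_dual"
    "\<And>x a. (x, a) \<in> E \<Longrightarrow> 0 \<le> \<psi> (x - z) + \<kappa> * (a - \<nu>)"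
    "\<exists>x a. (x, a) \<in> E \<and> 0 < \<psi> (x - z) + \<kappa> * (a - \<nu>)"
proof -
  define C where "C = (+) (- (z, \<nu>)) ` E"
  have C_iff: "p \<in> C \<longleftrightarrow> p + (z, \<nu>) \<in> E" for p
    unfolding C_def by (rule mem_translation_iff)
  have convC: "convex C"
    unfolding C_def using E(1) by (simp only: convex_translation)
  have C0: "0 \<in> C"
    using bottom(1) by (simp add: C_iff)
  have spanC: "p \<in> span C \<longleftrightarrow> p + (z, \<nu>) \<in> affine hull E" for p
  proof -
    have "span C = affine hull C"
      using C0 by (simp add: affine_hull_span_0 hull_inc)
    also have "\<dots> = (+) (- (z, \<nu>)) ` (affine hull E)"
      unfolding C_def by (rule affine_hull_translation)
    finally show ?thesis
      by (simp only: mem_translation_iff)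
  qed
  obtain z0 \<gamma> V where V: "(z0, \<gamma>) \<in> interior V" "V \<inter> closure (affine hull E) \<subseteq> E"
    and c0: "(z0, \<gamma>) \<in> E"
    using E(2) by (auto simp: ri_def)
  obtain A B where A: "open A" "z0 \<in> A" and B: "open B" "\<gamma> \<in> B" and AB: "A \<times> B \<subseteq> interior V"
    using open_prod_elim[OF open_interior V(1)] by (metis mem_Sigma_iff)
  obtain r where r: "r > 0" "ball \<gamma> r \<subseteq> B"
    using B by (meson openE)
  define A0 where "A0 = (\<lambda>x. z0 + x) -` A"
  have "open A0" "0 \<in> A0"
    unfolding A0_def using A by (auto intro!: open_vimage continuous_intros)
  then obtain V0 where V0: "convex V0" "0 \<in> interior V0" "V0 \<subseteq> A0"
    using locally_convex by blast
  \<comment> \<open>\<open>V1\<close> is the symmetric set that the separation needs; \<open>N\<close> is an open neighbourhood inside it.\<close>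
  define V1 where "V1 = V0 \<inter> uminus -` V0"
  define N where "N = interior V0 \<inter> uminus -` interior V0"
  have N: "open N" "0 \<in> N"
    unfolding N_def using V0(2) by (auto intro!: open_vimage continuous_intros)
  have NV1: "N \<subseteq> V1"
    unfolding N_def V1_def using interior_subset[of V0] by auto
  define W where "W = V1 \<times> ball (0::real) r"
  have convW: "convex W"
    unfolding W_def V1_def
    using V0(1) by (intro convex_Times convex_Int convex_linear_vimage linear_uminus convex_ball)
  have symW: "- p \<in> W" if "p \<in> W" for p
    using that by (auto simp: W_def V1_def)
  have absW: "\<exists>t>0. t *\<^sub>R p \<in> W" for p
  proof -
    obtain x a where p: "p = (x, a)"
      by force
    obtain \<delta> where \<delta>: "\<delta> > 0" "\<And>t. \<bar>t\<bar> < \<delta> \<Longrightarrow> t *\<^sub>R x \<in> N"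
      using open_contains_short_segment[OF N] by auto
    \<comment> \<open>The second bound keeps \<open>\<bar>t * a\<bar>\<close> strictly below \<open>r\<close>; the added 1 covers \<open>a = 0\<close>.\<close>
    define t where "t = min (\<delta> / 2) (r / (\<bar>a\<bar> + 1))"
    have t: "0 < t" "\<bar>t\<bar> < \<delta>" "t \<le> r / (\<bar>a\<bar> + 1)"
      using \<delta>(1) r(1) by (auto simp: t_def)
    then have "t * (\<bar>a\<bar> + 1) \<le> r"
      by (simp add: pos_le_divide_eq)
    then have "\<bar>t * a\<bar> < r"
      using t(1) by (simp add: abs_mult distrib_left)
    then show ?thesis
      using t(1) \<delta>(2)[OF t(2)] NV1 by (auto simp: p W_def intro!: exI[of _ t])
  qed
  define c where "c = (z0, \<gamma>) - (z, \<nu>)"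
  have int: "c + h \<in> C" if h: "h \<in> W" "h \<in> span C" for h
  proof -
    have "c \<in> C"
      using c0 by (simp add: C_iff c_def)
    then have "c + h \<in> span C"
      using span_add[OF span_base h(2)] by blast
    then have "(z0, \<gamma>) + h \<in> closure (affine hull E)"
      by (intro subsetD[OF closure_subset]) (simp add: spanC c_def algebra_simps)
    moreover have "(z0, \<gamma>) + h \<in> A \<times> B"
      using h(1) V0(3) r(2) by (force simp: W_def V1_def A0_def dist_real_def subset_iff)
    then have "(z0, \<gamma>) + h \<in> V"
      by (rule subsetD[OF order_trans[OF AB interior_subset]])
    ultimately have "(z0, \<gamma>) + h \<in> E"
      by (intro subsetD[OF V(2)] IntI)
    then show ?thesis
      by (simp add: C_iff c_def algebra_simps)
  qed
  have "(0, \<rho> - \<nu>) \<in> span C"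
    using above(1) by (intro span_base) (simp add: C_iff)
  then have e: "(0, - 1) \<in> span C"
    using span_scale[of "(0, \<rho> - \<nu>)" C "- 1 / (\<rho> - \<nu>)"] above(2) by (simp add: divide_simps)
  have e': "t *\<^sub>R (0, - 1) \<notin> C" if "0 < t" for t
    using bottom(2)[of "\<nu> - t"] that by (simp add: C_iff)
  have "\<exists>F. linear F \<and> (\<forall>x\<in>C. 0 \<le> F x) \<and> (0::real) < F c \<and> (\<forall>x\<in>W. F x \<le> 1)"
    by (rule separation_relative[OF convC C0 convW symW absW int e e'])
  then obtain F :: "'a \<times> real \<Rightarrow> real" where F: "linear F"
    "\<And>x. x \<in> C \<Longrightarrow> 0 \<le> F x" "0 < F c" "\<And>x. x \<in> W \<Longrightarrow> F x \<le> 1"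
    by metis
  define \<psi> where "\<psi> x = F (x, 0)" for x
  have lin: "linear \<psi>"
  proof (rule linearI)
    show "\<psi> (x + y) = \<psi> x + \<psi> y" for x y
      using linear_add[OF F(1), of "(x, 0)" "(y, 0)"] by (simp add: \<psi>_def)
    show "\<psi> (t *\<^sub>R x) = t *\<^sub>R \<psi> x" for t x
      using linear_scale[OF F(1), of t "(x, 0)"] by (simp add: \<psi>_def)
  qed
  define \<kappa> where "\<kappa> = F (0, 1)"
  have F_eq: "F (x, a) = \<psi> x + \<kappa> * a" for x a
    using linear_add[OF F(1), of "(x, 0)" "(0, a)"] linear_scale[OF F(1), of a "(0, 1)"]
    by (simp add: \<psi>_def \<kappa>_def)
  show thesis
  proof (rule that[of \<psi> \<kappa>])
    have "\<psi> x \<le> 1" if "x \<in> N" for x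
      using that NV1 r(1) F(4)[of "(x, 0)"] by (auto simp: \<psi>_def W_def)
    then show "\<psi> \<in> topological_dual"
      using lin continuous_linear_functionalI[OF lin N] by (simp add: topological_dual_def)
    show "0 \<le> \<psi> (x - z) + \<kappa> * (a - \<nu>)" if "(x, a) \<in> E" for x a
      using that F(2)[of "(x - z, a - \<nu>)"] by (simp add: F_eq C_iff)
    show "\<exists>x a. (x, a) \<in> E \<and> 0 < \<psi> (x - z) + \<kappa> * (a - \<nu>)"
      using c0 F(3) by (auto simp: F_eq c_def)
  qed
qed

section \<open>Conjugate duality\<close>

lemma weak_duality:
  assumes "\<And>x. f x \<noteq> - \<infinity>" "\<And>x. g x \<noteq> \<infinity>"
  shows "concave_conjugate g \<phi> - convex_conjugate f \<phi> \<le> (INF x. f x - g x)"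
proof (rule INF_greatest)
  fix x
  have "concave_conjugate g \<phi> - convex_conjugate f \<phi>
      \<le> (ereal (\<phi> x) - g x) - (ereal (\<phi> x) - f x)"
    unfolding concave_conjugate_def convex_conjugate_def
    by (intro ereal_minus_mono INF_lower SUP_upper) auto
  also have "\<dots> = f x - g x"
    using assms[of x] by (cases "f x"; cases "g x") auto
  finally show "concave_conjugate g \<phi> - convex_conjugate f \<phi> \<le> f x - g x" .
qed

text \<open>
  Fixing a real \<open>b \<le> g v\<close> bounds \<open>convex_conjugate f \<phi>\<close> from above, so both domains being nonempty makes it
  a real number; it can then be moved to the other side of the inequality, where the gap hypothesis
  bounds every term of \<open>concave_conjugate g \<phi>\<close> from below.
\<close>

lemma conjugate_gap_ge:
  fixes f g :: "'a \<Rightarrow> ereal"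
  assumes f: "\<And>x. f x \<noteq> - \<infinity>" "effective_dom f \<noteq> {}" and g: "\<And>x. g x \<noteq> \<infinity>" "concave_dom g \<noteq> {}"
    and gap: "\<And>u v a b. f u \<le> ereal a \<Longrightarrow> ereal b \<le> g v \<Longrightarrow> \<nu> + (\<phi> u - a) \<le> \<phi> v - b"
  shows "ereal \<nu> \<le> concave_conjugate g \<phi> - convex_conjugate f \<phi>"
proof -
  have upper: "convex_conjugate f \<phi> \<le> ereal (\<phi> v - b - \<nu>)" if b: "ereal b \<le> g v" for v b
    unfolding convex_conjugate_def
  proof (rule SUP_least)
    fix u
    show "ereal (\<phi> u) - f u \<le> ereal (\<phi> v - b - \<nu>)"
    proof (cases "f u")
      case (real a)
      then show ?thesis
        using gap[of u a b v] b by simp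
    qed (use f(1) in auto)
  qed
  obtain u where u: "f u < \<infinity>"
    using f(2) by (auto simp: effective_dom_def)
  have "ereal (\<phi> u) - f u \<le> convex_conjugate f \<phi>"
    unfolding convex_conjugate_def by (rule SUP_upper) simp
  then have "convex_conjugate f \<phi> \<noteq> - \<infinity>"
    using u f(1)[of u] by (cases "f u") auto
  moreover obtain v where v: "- \<infinity> < g v"
    using g(2) by (auto simp: concave_dom_def)
  have "convex_conjugate f \<phi> \<noteq> \<infinity>"
    using v g(1)[of v] upper[of "real_of_ereal (g v)" v] by (cases "g v") auto
  ultimately obtain \<kappa> where \<kappa>: "convex_conjugate f \<phi> = ereal \<kappa>"
    by (cases "convex_conjugate f \<phi>") auto
  have "ereal (\<nu> + \<kappa>) \<le> concave_conjugate g \<phi>"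
    unfolding concave_conjugate_def
  proof (rule INF_greatest)
    fix w
    show "ereal (\<nu> + \<kappa>) \<le> ereal (\<phi> w) - g w"
    proof (cases "g w")
      case (real b)
      then show ?thesis
        using upper[of b w] by (simp add: \<kappa>)
    qed (use g(1) in auto)
  qed
  then show ?thesis
    unfolding \<kappa> by (cases "concave_conjugate g \<phi>") auto
qed

lemma convex_hypo: "concave_fun g \<Longrightarrow> convex (hypo g)"
proof -
  assume "concave_fun g"
  then have "convex ((\<lambda>p. (fst p, - snd p)) -` epi (\<lambda>x. - g x))"
    unfolding concave_fun_def convex_fun_def
    by (intro convex_linear_vimage) (auto intro!: linearI)
  moreover have "(\<lambda>p. (fst p, - snd p)) -` epi (\<lambda>x. - g x) = hypo g"
    by (auto simp: epi_def hypo_def ereal_uminus_le_reorder)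
  ultimately show ?thesis
    by simp
qed

lemma convex_algebraic_diff: "convex A \<Longrightarrow> convex B \<Longrightarrow> convex (algebraic_diff A B)"
proof -
  assume "convex A" "convex B"
  moreover have "algebraic_diff A B = (\<Union>x\<in>A. \<Union>y\<in>B. {x - y})"
    by (auto simp: algebraic_diff_def)
  ultimately show ?thesis
    by (simp only: convex_differences)
qed

theorem corollary4p8:
  fixes f g :: "'a::locally_convex_real_vector \<Rightarrow> ereal"
  assumes "\<And>x. f x \<noteq> - \<infinity>" and "convex_fun f" and "proper_fun f"
    and "\<And>x. g x \<noteq> \<infinity>" and "concave_fun g" and "proper_concave_fun g"
    and "\<exists>xh. (INF x. f x - g x) = f xh - g xh"
    and "ri (algebraic_diff (effective_dom f) (concave_dom g)) \<noteq> {}"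
    and "ri (epi f) \<noteq> {}"
    and "ri (algebraic_diff (epi f) (hypo g)) \<noteq> {}"
    and "ri (effective_dom f) \<inter> ri (concave_dom g) \<noteq> {}"
  shows "(INF x. f x - g x)
    = (SUP \<phi>\<in>topological_dual. concave_conjugate g \<phi> - convex_conjugate f \<phi>)"
proof (rule antisym)
  show "(SUP \<phi>\<in>topological_dual. concave_conjugate g \<phi> - convex_conjugate f \<phi>)
      \<le> (INF x. f x - g x)"
    using weak_duality[of f g] assms(1,4) by (intro SUP_least) auto
next
  let ?E = "algebraic_diff (epi f) (hypo g)"
  obtain x\<^sub>0 where x0: "x\<^sub>0 \<in> ri (effective_dom f) \<inter> ri (concave_dom g)"
    using assms(11) by blast
  then have x0_dom: "f x\<^sub>0 < \<infinity>" "- \<infinity> < g x\<^sub>0"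
    by (auto simp: ri_def effective_dom_def concave_dom_def)
  obtain xh where xh: "(INF x. f x - g x) = f xh - g xh"
    using assms(7) by blast
  have "f xh - g xh \<le> f x\<^sub>0 - g x\<^sub>0"
    unfolding xh[symmetric] by (rule INF_lower) simp
  then have "f xh - g xh < \<infinity>"
    using x0_dom assms(1)[of x\<^sub>0] assms(4)[of x\<^sub>0] by (cases "f x\<^sub>0"; cases "g x\<^sub>0") auto
  then obtain \<alpha> \<beta> where fin: "f xh = ereal \<alpha>" "g xh = ereal \<beta>"
    using assms(1)[of xh] assms(4)[of xh] by (cases "f xh"; cases "g xh") auto
  define \<nu> where "\<nu> = \<alpha> - \<beta>"
  have inf: "(INF x. f x - g x) = ereal \<nu>"
    by (simp add: xh fin \<nu>_def)
  have E_I: "(u - v, a - b) \<in> ?E" if "f u \<le> ereal a" "ereal b \<le> g v" for u v a b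
    using that by (force simp: algebraic_diff_def epi_def hypo_def)
  have E_D: "\<exists>u v a b. f u \<le> ereal a \<and> ereal b \<le> g v \<and> x = u - v \<and> s = a - b"
    if "(x, s) \<in> ?E" for x s
    using that by (auto simp: algebraic_diff_def epi_def hypo_def)
  have convE: "convex ?E"
    using assms(2,5) by (intro convex_algebraic_diff convex_hypo) (auto simp: convex_fun_def)
  have bottom: "(0, \<nu>) \<in> ?E"
    using E_I[of xh \<alpha> \<beta> xh] by (simp add: fin \<nu>_def)
  have above: "(0, \<nu> + 1) \<in> ?E"
    using E_I[of xh "\<alpha> + 1" \<beta> xh] by (simp add: fin \<nu>_def algebra_simps)
  have below: "(0, \<mu>) \<notin> ?E" if "\<mu> < \<nu>" for \<mu>
  proof
    assume "(0, \<mu>) \<in> ?E"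
    then obtain u a b where uab: "f u \<le> ereal a" "ereal b \<le> g u" "\<mu> = a - b"
      using E_D by force
    have "ereal \<nu> \<le> f u - g u"
      unfolding inf[symmetric] by (rule INF_lower) simp
    also have "\<dots> \<le> ereal a - ereal b"
      using uab by (intro ereal_minus_mono)
    finally show False
      using uab that by simp
  qed
  obtain \<psi> \<kappa> where \<psi>: "\<psi> \<in> topological_dual"
    and supp: "\<And>x s. (x, s) \<in> ?E \<Longrightarrow> 0 \<le> \<psi> (x - 0) + \<kappa> * (s - \<nu>)"
    and proper: "\<exists>x s. (x, s) \<in> ?E \<and> 0 < \<psi> (x - 0) + \<kappa> * (s - \<nu>)"
    using supporting_functional_at_bottom[OF convE assms(10) bottom below above less_add_one] by blast
  have lin: "linear \<psi>" and cont: "continuous_on UNIV \<psi>"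
    using \<psi> by (auto simp: topological_dual_def)
  have "0 \<le> \<kappa>"
    using supp[OF above] by (simp add: linear_0[OF lin])
  moreover have "\<kappa> \<noteq> 0"
  proof
    assume \<kappa>0: "\<kappa> = 0"
    have nonneg: "0 \<le> \<psi> (u - v)" if uv: "u \<in> effective_dom f" "v \<in> concave_dom g" for u v
    proof -
      obtain a b where "f u \<le> ereal a" "ereal b \<le> g v"
        using uv assms(1)[of u] assms(4)[of v]
        by (cases "f u"; cases "g v") (auto simp: effective_dom_def concave_dom_def)
      then show ?thesis
        using supp[OF E_I[of u a b v]] \<kappa>0 by simp
    qed
    obtain u v a b where uv: "f u \<le> ereal a" "ereal b \<le> g v" "0 < \<psi> (u - v)"
      using proper E_D \<kappa>0 by force
    then have "u \<in> effective_dom f" "v \<in> concave_dom g"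
      by (auto simp: effective_dom_def concave_dom_def)
    then show False
      using nonneg_functional_vanishes[OF x0 lin nonneg] uv(3) by force
  qed
  ultimately have \<kappa>: "0 < \<kappa>"
    by simp
  define \<phi> where "\<phi> x = - \<psi> x / \<kappa>" for x
  have "\<phi> \<in> topological_dual"
    unfolding topological_dual_def \<phi>_def using lin cont \<kappa>
    by (auto intro!: linearI continuous_intros simp: linear_add[OF lin] linear_scale[OF lin] field_simps)
  moreover have "\<nu> + (\<phi> u - a) \<le> \<phi> v - b" if "f u \<le> ereal a" "ereal b \<le> g v" for u v a b
    using divide_nonneg_pos[OF supp[OF E_I[OF that]] \<kappa>] \<kappa>
    by (simp add: \<phi>_def linear_diff[OF lin] add_divide_distrib diff_divide_distrib)
  then have "ereal \<nu> \<le> concave_conjugate g \<phi> - convex_conjugate f \<phi>"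
    using assms(1,4) x0_dom
    by (intro conjugate_gap_ge) (auto simp: effective_dom_def concave_dom_def)
  ultimately show "(INF x. f x - g x)
      \<le> (SUP \<phi>\<in>topological_dual. concave_conjugate g \<phi> - convex_conjugate f \<phi>)"
    unfolding inf by (intro SUP_upper2[of \<phi>])
qed

end
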